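(* Let $m\geq 3$ be an integer, let $\beta>1$ be the real root greater than $1$ of $P(x)=x^m-\sum_{j=0}^{m-1}x^j$, and let $\mathbf p=(p_1,p_2)$ be any probability weight, i.e. $p_1,p_2>0$ and $p_1+p_2=1$. Let $\mu_{\mathbf p}$ be the self-similar probability measure on $[0,1]$ satisfying $\mu_{\mathbf p}=p_1\,\mu_{\mathbf p}\circ S_1^{-1}+p_2\,\mu_{\mathbf p}\circ S_2^{-1}$, where $S_1(x)=\frac{x}{\beta}$ and $S_2(x)=\frac{x}{\beta}+\left(1-\frac1\beta\right)$. Then $\mu_{\mathbf p}$ is not doubling.
   Context: The polynomial $P$ has exactly one real root greater than $1$, and this root satisfies $1<\beta<2$. The measure $\mu_{\mathbf p}$ is the unique Borel probability measure satisfying the stated self-similarity equation; its support is $[0,1]$, the attractor of the iterated function system $\{S_1,S_2\}$. A Borel probability measure $\mu$ on a metric space is called doubling if $\sup_{x\in \mathrm{supp}(\mu),\ r>0}\frac{\mu(B(x,2r))}{\mu(B(x,r))}<\infty$, where $B(x,r)$ is the ball with center $x$ and radius $r$. *)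

theory Defs
  imports "HOL-Probability.Probability" "HOL-Computational_Algebra.Polynomial"
begin

definition msupport :: "'a::topological_space measure \<Rightarrow> 'a set" where
  "msupport \<mu> = {x. \<forall>U. open U \<longrightarrow> x \<in> U \<longrightarrow> emeasure \<mu> U > 0}"

text \<open>
  Used for Borel probability measures. The supremum is taken in the extended nonnegative reals;
  the denominators are positive because the centres lie in the support.
\<close>
definition doubling_measure :: "'a::metric_space measure \<Rightarrow> bool" where
  "doubling_measure \<mu> \<longleftrightarrow>
     (SUP (x, r) \<in> msupport \<mu> \<times> {0<..}.
        emeasure \<mu> (ball x (2 * r)) / emeasure \<mu> (ball x r)) < \<infinity>"

definition multinacci_poly :: "nat \<Rightarrow> real poly" where
  "multinacci_poly m = monom 1 m - (\<Sum>j = 0..m - 1. monom 1 j)"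

definition S1 :: "real \<Rightarrow> real \<Rightarrow> real" where
  "S1 \<beta> x = x / \<beta>"

definition S2 :: "real \<Rightarrow> real \<Rightarrow> real" where
  "S2 \<beta> x = x / \<beta> + (1 - 1 / \<beta>)"

text \<open>
  A measure on the unit interval is represented as a Borel measure on the real line
  that is concentrated on \<open>{0..1}\<close>.
\<close>
definition self_similar_measure :: "real \<Rightarrow> real \<Rightarrow> real \<Rightarrow> real measure \<Rightarrow> bool" where
  "self_similar_measure \<beta> p1 p2 \<mu> \<longleftrightarrow>
     prob_space \<mu> \<and> sets \<mu> = sets borel \<and> measure \<mu> {0..1} = 1 \<and>
     (\<forall>A \<in> sets borel.
        measure \<mu> A = p1 * measure \<mu> (S1 \<beta> -` A) + p2 * measure \<mu> (S2 \<beta> -` A))"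

end

(* Write r = 1/beta and x = S2(0) = 1 - r. The map T = S1 o S2^(m-1) fixes x and contracts by r^m,
   since 2 r = 1 + r^(m+1). For m >= 3 one has r + r^2 < 1, so just to the left of x the
   only contribution to mu comes from T; hence mu of the left neighbourhoods of radius r^(m n)
   decays like q^n with q = p1 p2^(m-1). On the right of x there is the additional contribution
   S2[0, s), of mass p2 mu[0, s); it adds a term of order p1^(m n) at each step. If p1 >= p2, then
   p1^m >= q, so the right neighbourhoods have mass at least a constant times n q^n, which
   contradicts doubling at the points T^n(0). The case p1 < p2 follows by reflecting
   the measure in the point 1/2. *)
theory Submission
  imports Defs
begin

section \<open>Algebra of the root and of its reciprocal\<close>

lemma multinacci_root_eq:
  fixes \<beta> :: real
  assumes "m \<ge> 1" and "poly (multinacci_poly m) \<beta> = 0"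
  shows "\<beta> ^ m = (\<Sum>j<m. \<beta> ^ j)"
proof -
  have "{0..m - 1} = {..<m}" using assms(1) by auto
  then show ?thesis
    using assms(2) by (simp add: multinacci_poly_def poly_sum poly_monom)
qed

text \<open>Multiplying the root equation by \<open>\<beta> - 1\<close> telescopes the geometric
  sum; division by \<open>\<beta> ^ (m + 1)\<close> gives the claim.\<close>

lemma inverse_multinacci_root_eq:
  fixes \<beta> :: real
  assumes "m \<ge> 1" and "\<beta> > 1" and "poly (multinacci_poly m) \<beta> = 0"
  shows "2 * (1 / \<beta>) = 1 + (1 / \<beta>) ^ (m + 1)"
proof -
  have "\<beta> ^ m * (\<beta> - 1) = \<beta> ^ m - 1"
    using power_diff_1_eq[of \<beta> m] multinacci_root_eq[OF assms(1,3)]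
    by (simp add: mult.commute)
  then show ?thesis using assms(2) by (simp add: field_simps)
qed

text \<open>Of the sum equal to \<open>\<beta> ^ m\<close> only the three top powers are kept, which
  is where \<open>m \<ge> 3\<close> enters. The cubic term is the room that \<open>L_step\<close>
  needs.\<close>

lemma inverse_multinacci_root_bound:
  fixes \<beta> :: real
  assumes "m \<ge> 3" and "\<beta> > 1" and "poly (multinacci_poly m) \<beta> = 0"
  shows "1 / \<beta> + (1 / \<beta>)\<^sup>2 + (1 / \<beta>) ^ 3 \<le> 1"
proof -
  obtain k where m: "m = k + 3" using assms(1) by (metis add.commute le_Suc_ex)
  have "(\<Sum>j<m. \<beta> ^ j) = (\<Sum>j<k. \<beta> ^ j) + \<beta> ^ k + \<beta> ^ (k+1) + \<beta> ^ (k+2)"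
    by (simp add: m eval_nat_numeral)
  moreover have "(\<Sum>j<k. \<beta> ^ j) \<ge> 0" using assms(2) by (intro sum_nonneg) auto
  ultimately have "\<beta> ^ k * (1 + \<beta> + \<beta>\<^sup>2) \<le> \<beta> ^ k * \<beta> ^ 3"
    using multinacci_root_eq[of m \<beta>] assms by (simp add: m algebra_simps power2_eq_square power_add)
  then have "1 + \<beta> + \<beta>\<^sup>2 \<le> \<beta> ^ 3" using assms(2) by simp
  then show ?thesis using assms(2) by (simp add: field_simps power2_eq_square power3_eq_cube)
qed

text \<open>Replaces the extended-valued supremum by one real constant; centres in the support keep
  the denominators nonzero.\<close>

lemma doubling_measureD:
  assumes "finite_measure \<mu>" and "doubling_measure \<mu>"
  obtains D where "\<And>x r. x \<in> msupport \<mu> \<Longrightarrow> r > 0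
    \<Longrightarrow> measure \<mu> (ball x (2 * r)) \<le> D * measure \<mu> (ball x r)"
proof -
  interpret finite_measure \<mu> by fact
  define D where "D = (SUP (x, r) \<in> msupport \<mu> \<times> {0<..}.
        emeasure \<mu> (ball x (2 * r)) / emeasure \<mu> (ball x r))"
  have D: "D < \<infinity>" using assms(2) by (simp add: doubling_measure_def D_def)
  show ?thesis
  proof (rule that[of "enn2real D"])
    fix x and r :: real
    assume x: "x \<in> msupport \<mu>" and r: "r > 0"
    have le: "emeasure \<mu> (ball x (2 * r)) / emeasure \<mu> (ball x r) \<le> D"
      unfolding D_def using x r by (intro SUP_upper2[of "(x, r)"]) auto
    have pos: "emeasure \<mu> (ball x r) \<noteq> 0"
      using x r by (auto simp: msupport_def dest!: spec[of _ "ball x r"])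
    have "measure \<mu> (ball x (2 * r)) / measure \<mu> (ball x r) \<le> enn2real D"
      using enn2real_mono[OF le] D pos
      by (simp add: emeasure_eq_measure divide_ennreal zero_less_measure_iff)
    then show "measure \<mu> (ball x (2 * r)) \<le> enn2real D * measure \<mu> (ball x r)"
      using pos by (simp add: emeasure_eq_measure pos_divide_le_eq zero_less_measure_iff)
  qed
qed

section \<open>The self-similar measure and its support\<close>

text \<open>A locale allows a second instantiation, for the reflected measure with exchanged
  weights.\<close>

locale multinacci_measure =
  fixes m :: nat and \<beta> p1 p2 :: real and \<mu> :: "real measure"
  assumes m: "m \<ge> 3"
    and \<beta>: "\<beta> > 1" and root: "poly (multinacci_poly m) \<beta> = 0"
    and p1: "p1 > 0" and p2: "p2 > 0"
    and ssm: "self_similar_measure \<beta> p1 p2 \<mu>"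
begin

sublocale prob_space \<mu>
  using ssm by (simp add: self_similar_measure_def)

lemma sets_\<mu> [simp]: "sets \<mu> = sets borel"
  using ssm by (simp add: self_similar_measure_def)

lemma space_\<mu> [simp]: "space \<mu> = UNIV"
  using sets_eq_imp_space_eq[OF sets_\<mu>] by simp

lemma self_similar:
  "A \<in> sets borel \<Longrightarrow> measure \<mu> A = p1 * measure \<mu> (S1 \<beta> -` A) + p2 * measure \<mu> (S2 \<beta> -` A)"
  using ssm by (simp add: self_similar_measure_def)

lemma measure_outside:
  assumes "A \<in> sets borel" and "A \<inter> {0..1} = {}"
  shows "measure \<mu> A = 0"
proof -
  have "measure \<mu> (A \<union> {0..1}) = measure \<mu> A + measure \<mu> {0..1}"
    using assms by (intro finite_measure_Union) auto
  moreover have "measure \<mu> {0..1} = 1" using ssm by (simp add: self_similar_measure_def)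
  ultimately show ?thesis
    using prob_le_1[of "A \<union> {0..1}"] measure_nonneg[of \<mu> A] by linarith
qed

lemma measure_ge_S1: "A \<in> sets borel \<Longrightarrow> p1 * measure \<mu> (S1 \<beta> -` A) \<le> measure \<mu> A"
  using self_similar[of A] p2 by simp

lemma measure_ge_S2: "A \<in> sets borel \<Longrightarrow> p2 * measure \<mu> (S2 \<beta> -` A) \<le> measure \<mu> A"
  using self_similar[of A] p1 by simp

definition \<rho> :: real where "\<rho> = 1 / \<beta>"

lemma \<rho>_pos: "0 < \<rho>" and \<rho>_less_1: "\<rho> < 1"
  using \<beta> by (simp_all add: \<rho>_def)

lemma \<rho>_eq: "2 * \<rho> = 1 + \<rho> ^ (m + 1)"
  using inverse_multinacci_root_eq[of m \<beta>] m \<beta> root by (simp add: \<rho>_def)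

lemma \<rho>_bound: "\<rho> + \<rho>\<^sup>2 + \<rho> ^ 3 \<le> 1"
  using inverse_multinacci_root_bound[OF m \<beta> root] by (simp add: \<rho>_def)

text \<open>Each map is written as a contraction about its fixed point, 0 or 1, so that iterates
  only change the power of \<open>\<rho>\<close>.\<close>

lemma S1_eq: "S1 \<beta> z = \<rho> * z" and S2_eq: "S2 \<beta> z = 1 - \<rho> * (1 - z)"
  by (simp_all add: S1_def S2_def \<rho>_def algebra_simps diff_divide_distrib)

text \<open>The preimage of a neighbourhood of the image point is a neighbourhood of
  \<open>z\<close>, and self-similarity passes on the fraction \<open>p1\<close> of its
  mass.\<close>

lemma msupport_S1: "z \<in> msupport \<mu> \<Longrightarrow> S1 \<beta> z \<in> msupport \<mu>"
proof -
  assume z: "z \<in> msupport \<mu>"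
  have "emeasure \<mu> U > 0" if U: "open U" "S1 \<beta> z \<in> U" for U
  proof -
    have "open (S1 \<beta> -` U)"
      using U(1) unfolding S1_def by (intro open_vimage continuous_intros) (use \<beta> in auto)
    with z U(2) have "measure \<mu> (S1 \<beta> -` U) > 0"
      by (auto simp: msupport_def emeasure_eq_measure)
    then have "p1 * measure \<mu> (S1 \<beta> -` U) > 0" using p1 by simp
    with measure_ge_S1[of U] U(1) have "measure \<mu> U > 0" by simp
    then show ?thesis by (simp add: emeasure_eq_measure)
  qed
  then show ?thesis by (simp add: msupport_def)
qed

lemma msupport_S2: "z \<in> msupport \<mu> \<Longrightarrow> S2 \<beta> z \<in> msupport \<mu>"
proof -
  assume z: "z \<in> msupport \<mu>"
  have "emeasure \<mu> U > 0" if U: "open U" "S2 \<beta> z \<in> U" for U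
  proof -
    have "open (S2 \<beta> -` U)"
      using U(1) unfolding S2_def by (intro open_vimage continuous_intros) (use \<beta> in auto)
    with z U(2) have "measure \<mu> (S2 \<beta> -` U) > 0"
      by (auto simp: msupport_def emeasure_eq_measure)
    then have "p2 * measure \<mu> (S2 \<beta> -` U) > 0" using p2 by simp
    with measure_ge_S2[of U] U(1) have "measure \<mu> U > 0" by simp
    then show ?thesis by (simp add: emeasure_eq_measure)
  qed
  then show ?thesis by (simp add: msupport_def)
qed

section \<open>Scaling of the measure near the two endpoints\<close>

lemma measure_near_0_ge: "p1 ^ k * measure \<mu> {a..<b} \<le> measure \<mu> {\<rho> ^ k * a..<\<rho> ^ k * b}"
proof (induction k)
  case (Suc k)
  have "S1 \<beta> -` {\<rho> ^ Suc k * a..<\<rho> ^ Suc k * b} = {\<rho> ^ k * a..<\<rho> ^ k * b}"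
    using \<rho>_pos by (auto simp: S1_eq mult.assoc)
  then have "p1 * measure \<mu> {\<rho> ^ k * a..<\<rho> ^ k * b} \<le> measure \<mu> {\<rho> ^ Suc k * a..<\<rho> ^ Suc k * b}"
    using measure_ge_S1[of "{\<rho> ^ Suc k * a..<\<rho> ^ Suc k * b}"] by simp
  moreover have "p1 ^ Suc k * measure \<mu> {a..<b} \<le> p1 * measure \<mu> {\<rho> ^ k * a..<\<rho> ^ k * b}"
    using mult_left_mono[OF Suc, of p1] p1 by (simp add: mult.assoc)
  ultimately show ?case by (rule order_trans[rotated])
qed simp

lemma measure_near_1_ge:
  "p2 ^ k * measure \<mu> {a..<b} \<le> measure \<mu> {1 - \<rho> ^ k * (1 - a)..<1 - \<rho> ^ k * (1 - b)}"
proof (induction k)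
  case (Suc k)
  let ?I = "\<lambda>k. {1 - \<rho> ^ k * (1 - a)..<1 - \<rho> ^ k * (1 - b)}"
  have "S2 \<beta> -` ?I (Suc k) = ?I k"
    using \<rho>_pos by (auto simp: S2_eq mult.assoc)
  then have "p2 * measure \<mu> (?I k) \<le> measure \<mu> (?I (Suc k))"
    using measure_ge_S2[of "?I (Suc k)"] by simp
  moreover have "p2 ^ Suc k * measure \<mu> {a..<b} \<le> p2 * measure \<mu> (?I k)"
    using mult_left_mono[OF Suc, of p2] p2 by (simp add: mult.assoc)
  ultimately show ?case by (rule order_trans[rotated])
qed simp

text \<open>Only \<open>S2\<close> contributes here: \<open>S1\<close> maps \<open>{0..1}\<close> into \<open>{0..\<rho>}\<close>, to the left of all these intervals.\<close>
lemma measure_near_1_le: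
  assumes "\<rho> \<le> 1 - \<rho> * (1 - a)" and "a \<le> 1"
  shows "measure \<mu> {1 - \<rho> ^ k * (1 - a)<..<1 - \<rho> ^ k * (1 - b)} \<le> p2 ^ k * measure \<mu> {a<..<b}"
proof (induction k)
  case (Suc k)
  let ?A = "{1 - \<rho> ^ Suc k * (1 - a)<..<1 - \<rho> ^ Suc k * (1 - b)}"
  have "\<rho> ^ k \<le> 1" using \<rho>_pos \<rho>_less_1 by (simp add: power_le_one)
  then have "\<rho> ^ k * (\<rho> * (1 - a)) \<le> 1 * (\<rho> * (1 - a))"
    using assms(2) \<rho>_pos by (intro mult_right_mono) auto
  then have "?A \<subseteq> {\<rho><..}" using assms(1) by (auto simp: algebra_simps)
  then have "S1 \<beta> -` ?A \<subseteq> {1<..}" using \<rho>_pos by (auto simp: S1_eq)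
  moreover have "S1 \<beta> -` ?A \<in> sets borel"
    by (intro borel_open open_vimage) (use \<beta> in \<open>auto simp: S1_def intro!: continuous_intros\<close>)
  ultimately have "measure \<mu> (S1 \<beta> -` ?A) = 0" by (intro measure_outside) force+
  moreover have "S2 \<beta> -` ?A = {1 - \<rho> ^ k * (1 - a)<..<1 - \<rho> ^ k * (1 - b)}"
    using \<rho>_pos by (auto simp: S2_eq mult.assoc)
  ultimately have "measure \<mu> ?A = p2 * measure \<mu> {1 - \<rho> ^ k * (1 - a)<..<1 - \<rho> ^ k * (1 - b)}"
    using self_similar[of ?A] by simp
  then show ?case using mult_left_mono[OF Suc, of p2] p2 by (simp add: mult.assoc)
qed simp

lemma zero_in_msupport: "0 \<in> msupport \<mu>"
proof -
  have "emeasure \<mu> U > 0" if U: "open U" "0 \<in> U" for U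
  proof -
    obtain e where e: "e > 0" "ball 0 e \<subseteq> U" using U open_contains_ball by blast
    \<comment> \<open>The interval \<open>{0..<2}\<close> has full mass, and its image under
      \<open>k\<close> applications of \<open>S1\<close> has length
      \<open>2 * \<rho> ^ k\<close>.\<close>
    obtain k where k: "\<rho> ^ k < e / 2"
      using real_arch_pow_inv[of "e/2" \<rho>] e \<rho>_less_1 by auto
    have "{0..1} \<subseteq> {0..<2::real}" by auto
    then have "measure \<mu> {0..<2} \<ge> 1"
      using finite_measure_mono[of "{0..1}" "{0..<2}"] ssm by (simp add: self_similar_measure_def)
    then have "0 < p1 ^ k * measure \<mu> {0..<2}" using p1 by simp
    also have "\<dots> \<le> measure \<mu> {0..<\<rho> ^ k * 2}" using measure_near_0_ge[of k 0 2] by simp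
    also have "\<dots> \<le> measure \<mu> U"
      using e k U(1) by (intro finite_measure_mono) (auto simp: subset_eq dist_real_def)
    finally show ?thesis by (simp add: emeasure_eq_measure)
  qed
  then show ?thesis by (simp add: msupport_def)
qed

section \<open>The fixed point of \<open>T\<close> and the orbit of 0\<close>

text \<open>The right side is \<open>T\<close> at \<open>1 - \<rho>\<close>: applying
  \<open>S2\<close> to that point \<open>m - 1\<close> times gives \<open>1 - \<rho> ^ m\<close>,
  and \<open>S1\<close> multiplies by \<open>\<rho>\<close>.\<close>

lemma fixed_point: "1 - \<rho> = \<rho> - \<rho> ^ m * \<rho>"
  using \<rho>_eq by simp

lemma T_in_msupport:
  assumes "z \<in> msupport \<mu>"
  shows "(1 - \<rho>) + \<rho> ^ m * (z - (1 - \<rho>)) \<in> msupport \<mu>"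
proof -
  have "1 - \<rho> ^ k * (1 - z) \<in> msupport \<mu>" for k
  proof (induction k)
    case (Suc k)
    then show ?case using msupport_S2[OF Suc] by (simp add: S2_eq mult.assoc)
  qed (use assms in simp)
  from msupport_S1[OF this[of "m - 1"]]
  have "\<rho> - \<rho> ^ m * (1 - z) \<in> msupport \<mu>"
    using m by (simp add: S1_eq algebra_simps flip: power_Suc2 power_Suc)
  moreover have "\<rho> - \<rho> ^ m * (1 - z) = (1 - \<rho>) + \<rho> ^ m * (z - (1 - \<rho>))"
    using fixed_point by (simp add: algebra_simps)
  ultimately show ?thesis by simp
qed

text \<open>These points are the iterates of 0 under \<open>T\<close>, the centres of the balls that
  will violate doubling.\<close>

lemma T_power_in_msupport: "(1 - \<rho>) * (1 - \<rho> ^ (m * n)) \<in> msupport \<mu>"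
proof (induction n)
  case (Suc n)
  show ?case using T_in_msupport[OF Suc] by (simp add: algebra_simps power_add)
qed (simp add: zero_in_msupport)

section \<open>One-sided neighbourhoods of the fixed point\<close>

text \<open>The fixed point is counted on the right side only, so the preimage of the left interval
  under \<open>S2\<close> lies strictly below 0.\<close>

definition L :: "real \<Rightarrow> real" where "L s = measure \<mu> {1 - \<rho> - s<..<1 - \<rho>}"
definition R :: "real \<Rightarrow> real" where "R s = measure \<mu> {1 - \<rho>..<1 - \<rho> + s}"

lemma m_power: "\<rho> ^ m = \<rho> * \<rho> ^ (m - 1)"
  using m by (simp flip: power_Suc)

text \<open>Factors \<open>T\<close> through \<open>S1\<close>; negative \<open>s\<close> serves the
  left neighbourhoods.\<close>

lemma scaled_endpoint:
  "1 - \<rho> + \<rho> ^ m * s = \<rho> * (1 - \<rho> ^ (m - 1) * (1 - (1 - \<rho> + s)))"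
  using fixed_point by (simp add: m_power algebra_simps)

lemma L_step:
  assumes "0 \<le> s" and "s \<le> \<rho>\<^sup>2"
  shows "L (\<rho> ^ m * s) \<le> p1 * p2 ^ (m - 1) * L s"
proof -
  let ?A = "{1 - \<rho> - \<rho> ^ m * s<..<1 - \<rho>}"
  let ?B = "{1 - \<rho> ^ (m - 1) * (1 - (1 - \<rho> - s))<..<1 - \<rho> ^ (m - 1) * (1 - (1 - \<rho>))}"
  have "S2 \<beta> -` ?A \<subseteq> {..<0}"
    using \<rho>_pos by (auto simp: S2_eq algebra_simps mult_less_0_iff)
  moreover have "S2 \<beta> -` ?A \<in> sets borel"
    by (intro borel_open open_vimage) (use \<beta> in \<open>auto simp: S2_def intro!: continuous_intros\<close>)
  ultimately have "measure \<mu> (S2 \<beta> -` ?A) = 0" by (intro measure_outside) force+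
  moreover have "S1 \<beta> -` ?A = ?B"
  proof -
    have "?A = {\<rho> * (1 - \<rho> ^ (m - 1) * (1 - (1 - \<rho> - s)))<..<\<rho> * (1 - \<rho> ^ (m - 1) * (1 - (1 - \<rho>)))}"
      using scaled_endpoint[of "- s"] scaled_endpoint[of 0]
      by (intro arg_cong2[where f = greaterThanLessThan]) simp_all
    then show ?thesis using \<rho>_pos by (auto simp: S1_eq)
  qed
  ultimately have "L (\<rho> ^ m * s) = p1 * measure \<mu> ?B"
    using self_similar[of ?A] by (simp add: L_def)
  also have "measure \<mu> ?B \<le> p2 ^ (m - 1) * L s"
    unfolding L_def
  proof (rule measure_near_1_le)
    \<comment> \<open>The requirement is
      \<open>\<rho> + \<rho>\<^sup>2 + \<rho> * s \<le> 1\<close>, so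
      \<open>s \<le> \<rho>\<^sup>2\<close> reduces it to \<open>\<rho>_bound\<close>.\<close>
    have "\<rho> * s \<le> \<rho> * \<rho>\<^sup>2" using assms \<rho>_pos by (intro mult_left_mono) auto
    then show "\<rho> \<le> 1 - \<rho> * (1 - (1 - \<rho> - s))"
      using \<rho>_bound by (simp add: algebra_simps power2_eq_square power3_eq_cube)
    show "1 - \<rho> - s \<le> 1" using assms \<rho>_pos by simp
  qed
  finally show ?thesis using p1 by (simp add: mult.assoc)
qed

text \<open>The first summand is the \<open>S2\<close> part, since \<open>S2\<close> sends 0 to
  \<open>1 - \<rho>\<close>; the second bounds the \<open>S1\<close> part from below by following
  \<open>T\<close>.\<close>

lemma R_step:
  "p2 * measure \<mu> {0..<\<rho> ^ (m - 1) * s} + p1 * p2 ^ (m - 1) * R s \<le> R (\<rho> ^ m * s)"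
proof -
  let ?A = "{1 - \<rho>..<1 - \<rho> + \<rho> ^ m * s}"
  let ?B = "{1 - \<rho> ^ (m - 1) * (1 - (1 - \<rho>))..<1 - \<rho> ^ (m - 1) * (1 - (1 - \<rho> + s))}"
  have "S1 \<beta> -` ?A = ?B"
  proof -
    have "?A = {\<rho> * (1 - \<rho> ^ (m - 1) * (1 - (1 - \<rho>)))..<\<rho> * (1 - \<rho> ^ (m - 1) * (1 - (1 - \<rho> + s)))}"
      using scaled_endpoint[of 0] by (intro arg_cong2[where f = atLeastLessThan] scaled_endpoint) simp
    then show ?thesis using \<rho>_pos by (auto simp: S1_eq)
  qed
  moreover have "S2 \<beta> -` ?A = {0..<\<rho> ^ (m - 1) * s}"
  proof -
    have "?A = {1 - \<rho> * (1 - 0)..<1 - \<rho> * (1 - \<rho> ^ (m - 1) * s)}"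
      by (simp add: m_power algebra_simps)
    then show ?thesis using \<rho>_pos by (auto simp: S2_eq mult_le_cancel_left mult_less_cancel_left)
  qed
  ultimately have "R (\<rho> ^ m * s) = p1 * measure \<mu> ?B + p2 * measure \<mu> {0..<\<rho> ^ (m - 1) * s}"
    using self_similar[of ?A] by (simp add: R_def)
  moreover have "p1 * (p2 ^ (m - 1) * R s) \<le> p1 * measure \<mu> ?B"
    unfolding R_def using p1 by (intro mult_left_mono measure_near_1_ge) auto
  ultimately show ?thesis by (simp add: mult.assoc)
qed

text \<open>Twice the distance from the \<open>n\<close>-th iterate of 0 under \<open>T\<close> to
  the fixed point, which makes this iterate the midpoint of the left interval.\<close>

definition scale :: "nat \<Rightarrow> real" where "scale n = \<rho> ^ (m * n) * (2 * (1 - \<rho>))"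

lemma scale_Suc: "scale (Suc n) = \<rho> ^ m * scale n"
  by (simp add: scale_def power_add)

lemma scale_pos: "scale n > 0"
  using \<rho>_pos \<rho>_less_1 by (simp add: scale_def)

lemma scale_Suc_le: "scale (Suc n) \<le> \<rho>\<^sup>2"
proof -
  have "\<rho> ^ (m * Suc n) \<le> \<rho> ^ 3"
    using m \<rho>_pos \<rho>_less_1 by (intro power_decreasing) (auto simp: trans_le_add1)
  then have "scale (Suc n) \<le> \<rho> ^ 3 * (2 * (1 - \<rho>))"
    unfolding scale_def using \<rho>_less_1 by (intro mult_right_mono) auto
  also have "\<dots> = \<rho>\<^sup>2 * (2 * \<rho> * (1 - \<rho>))"
    by (simp add: power2_eq_square power3_eq_cube)
  also have "\<dots> \<le> \<rho>\<^sup>2 * 1"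
  proof (rule mult_left_mono)
    have "1 - 2 * \<rho> * (1 - \<rho>) = \<rho>\<^sup>2 + (1 - \<rho>)\<^sup>2" by (simp add: power2_eq_square algebra_simps)
    then show "2 * \<rho> * (1 - \<rho>) \<le> 1" by (smt (verit) zero_le_power2)
  qed simp
  finally show ?thesis by simp
qed

text \<open>Iterates \<open>L_step\<close> from index 1, where \<open>scale_Suc_le\<close> supplies
  its size condition; the base case is the trivial bound 1.\<close>

lemma L_scale_le: "L (scale (Suc n)) \<le> (p1 * p2 ^ (m - 1)) ^ n"
proof (induction n)
  case 0
  show ?case by (simp add: L_def)
next
  case (Suc n)
  have "L (scale (Suc (Suc n))) \<le> p1 * p2 ^ (m - 1) * L (scale (Suc n))"
    unfolding scale_Suc[of "Suc n"] using scale_pos scale_Suc_le by (intro L_step) (auto intro: less_imp_le)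
  also have "\<dots> \<le> p1 * p2 ^ (m - 1) * (p1 * p2 ^ (m - 1)) ^ n"
    using Suc p1 p2 by (intro mult_left_mono) auto
  finally show ?case by simp
qed

text \<open>Each \<open>R_step\<close> multiplies by \<open>p1 * p2 ^ (m - 1)\<close> and adds at
  least a fixed multiple of the current power of it, hence the linear factor. The extra factor on
  the right avoids the exponent \<open>n - 1\<close>.\<close>

lemma R_scale_ge:
  assumes "p2 \<le> p1"
  shows "real n * (p2 * measure \<mu> {0..<\<rho> ^ (m - 1) * scale 0}) * (p1 * p2 ^ (m - 1)) ^ n
    \<le> p1 * p2 ^ (m - 1) * R (scale n)"
proof (induction n)
  case 0
  show ?case using p1 p2 by (simp add: R_def)
next
  case (Suc n)
  let ?q = "p1 * p2 ^ (m - 1)"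
  let ?c = "p2 * measure \<mu> {0..<\<rho> ^ (m - 1) * scale 0}"
  have q: "?q > 0" using p1 p2 by simp
  \<comment> \<open>Here \<open>p2 \<le> p1\<close> ensures that the added mass near 0 decays no
    faster than \<open>?q ^ n\<close>.\<close>
  have "p2 ^ (m - 1) \<le> p1 ^ (m - 1)" using assms p2 by (intro power_mono) auto
  then have "?q \<le> p1 ^ m" using m p1 by (simp add: power_eq_if)
  then have "?q ^ n \<le> p1 ^ (m * n)" using q by (simp add: power_mult power_mono)
  then have "?c * ?q ^ n \<le> ?c * p1 ^ (m * n)" using p2 by (intro mult_left_mono) auto
  also have "\<dots> \<le> p2 * measure \<mu> {0..<\<rho> ^ (m - 1) * scale n}"
    using measure_near_0_ge[of "m * n" 0 "\<rho> ^ (m - 1) * scale 0"] p2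
    by (simp add: scale_def ac_simps)
  finally have "?c * ?q ^ n + ?q * R (scale n) \<le> R (scale (Suc n))"
    using R_step[of "scale n"] by (simp add: scale_Suc)
  with Suc.IH have "?c * ?q ^ n + real n * ?c * ?q ^ n \<le> R (scale (Suc n))" by linarith
  then have "?q * (?c * ?q ^ n + real n * ?c * ?q ^ n) \<le> ?q * R (scale (Suc n))"
    using q by (intro mult_left_mono) auto
  then show ?case by (simp add: algebra_simps)
qed

section \<open>Contradiction with doubling when \<open>p2 \<le> p1\<close>\<close>

lemma ball_ratio_unbounded:
  assumes "p2 \<le> p1"
  shows "\<exists>z\<in>msupport \<mu>. \<exists>r>0. measure \<mu> (ball z (2 * r)) > D * measure \<mu> (ball z r)"
proof (rule ccontr)
  assume "\<not> ?thesis"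
  then have D: "measure \<mu> (ball z (2 * r)) \<le> D * measure \<mu> (ball z r)"
    if "z \<in> msupport \<mu>" "r > 0" for z r
    using that by (meson not_le_imp_less)
  let ?q = "p1 * p2 ^ (m - 1)"
  define c where "c = p2 * measure \<mu> {0..<\<rho> ^ (m - 1) * scale 0}"
  have q: "?q > 0" using p1 p2 by simp
  \<comment> \<open>A neighbourhood of the support point 0 has positive mass, none of it below
    0.\<close>
  have c: "c > 0"
  proof -
    let ?t = "\<rho> ^ (m - 1) * scale 0"
    have t: "?t > 0" using scale_pos \<rho>_pos by simp
    then have "emeasure \<mu> {-?t<..<?t} > 0"
      using zero_in_msupport by (auto simp: msupport_def)
    moreover have "measure \<mu> {-?t<..<?t} \<le> measure \<mu> ({..<0} \<union> {0..<?t})"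
      by (intro finite_measure_mono) auto
    moreover have "measure \<mu> ({..<0} \<union> {0..<?t}) \<le> measure \<mu> {..<0} + measure \<mu> {0..<?t}"
      by (intro measure_Un_le) auto
    moreover have "measure \<mu> {..<0} = 0" by (intro measure_outside) auto
    ultimately have "measure \<mu> {0..<?t} > 0" by (simp add: emeasure_eq_measure)
    then show ?thesis using p2 by (simp add: c_def)
  qed
  have bound: "real (Suc n) * c \<le> D\<^sup>2" for n
  proof -
    define z where "z = (1 - \<rho>) * (1 - \<rho> ^ (m * Suc n))"
    define r where "r = scale (Suc n) / 2"
    have z: "z \<in> msupport \<mu>" unfolding z_def by (rule T_power_in_msupport)
    have r: "r > 0" using scale_pos by (simp add: r_def)
    have zr: "z = 1 - \<rho> - r" by (simp add: z_def r_def scale_def field_simps)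
    have "measure \<mu> (ball z r) = L (scale (Suc n))"
      unfolding L_def by (rule arg_cong[of _ _ "measure \<mu>"]) (auto simp: ball_eq_greaterThanLessThan zr r_def)
    with L_scale_le have l: "measure \<mu> (ball z r) \<le> ?q ^ n" by simp
    \<comment> \<open>The sign of \<open>D\<close> must be known before inequalities are multiplied
      by it.\<close>
    have "0 \<le> D * measure \<mu> (ball z r)" using D[OF z r] measure_nonneg order_trans by blast
    moreover have "measure \<mu> (ball z r) > 0"
      using z r by (auto simp: msupport_def emeasure_eq_measure dest!: spec[of _ "ball z r"])
    ultimately have D0: "D \<ge> 0" by (simp add: zero_le_mult_iff)
    \<comment> \<open>The right interval ends at distance \<open>3 * r\<close> from
      \<open>z\<close>, so two doublings are used, whence \<open>D\<^sup>2\<close>.\<close>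
    have "R (scale (Suc n)) \<le> measure \<mu> (ball z (2 * (2 * r)))"
      unfolding R_def using r
      by (intro finite_measure_mono) (auto simp: ball_eq_greaterThanLessThan zr r_def)
    also have "\<dots> \<le> D * measure \<mu> (ball z (2 * r))" using D[OF z, of "2 * r"] r by simp
    also have "\<dots> \<le> D * (D * measure \<mu> (ball z r))" using D[OF z r] D0 by (intro mult_left_mono)
    also have "\<dots> \<le> D * (D * ?q ^ n)" using l D0 by (intro mult_left_mono)
    finally have "R (scale (Suc n)) \<le> D\<^sup>2 * ?q ^ n"
      by (simp add: power2_eq_square mult.assoc)
    then have "?q * R (scale (Suc n)) \<le> ?q * (D\<^sup>2 * ?q ^ n)"
      using q by (intro mult_left_mono) auto
    with R_scale_ge[OF assms, of "Suc n"]
    have "real (Suc n) * c * ?q ^ Suc n \<le> ?q * (D\<^sup>2 * ?q ^ n)"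
      unfolding c_def by linarith
    then have "(real (Suc n) * c) * ?q ^ Suc n \<le> D\<^sup>2 * ?q ^ Suc n" by (simp add: ac_simps)
    then show ?thesis using q zero_less_power[OF q, of "Suc n"] mult_le_cancel_right_pos by blast
  qed
  obtain n where "D\<^sup>2 / c < real n" using reals_Archimedean2 by blast
  then have "D\<^sup>2 < real n * c" using c by (simp add: field_simps)
  also have "\<dots> \<le> real (Suc n) * c" using c by simp
  finally show False using bound[of n] by simp
qed

section \<open>Reflection and the case \<open>p1 < p2\<close>\<close>

lemma measurable_reflection [measurable]: "(\<lambda>x. 1 - x) \<in> borel_measurable \<mu>"
  by (subst measurable_cong_sets[OF sets_\<mu> refl]) simp

text \<open>Conjugation by the reflection exchanges \<open>S1\<close> and \<open>S2\<close>, and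
  hence the weights.\<close>

lemma reflection:
  "multinacci_measure m \<beta> p2 p1 (distr \<mu> borel (\<lambda>x. 1 - x))"
proof
  let ?f = "\<lambda>x::real. 1 - x"
  have eq: "measure (distr \<mu> borel ?f) A = measure \<mu> (?f -` A)" if "A \<in> sets borel" for A
    using that by (simp add: measure_distr)
  have vimage: "?f -` A \<in> sets borel" if "A \<in> sets borel" for A
    using measurable_sets[OF measurable_reflection that] by simp
  have S: "S1 \<beta> (1 - x) = 1 - S2 \<beta> x" "S2 \<beta> (1 - x) = 1 - S1 \<beta> x" for x
    by (simp_all add: S1_eq S2_eq algebra_simps)
  have S_meas: "S1 \<beta> \<in> borel_measurable borel" "S2 \<beta> \<in> borel_measurable borel"
    by (simp_all add: S1_def[abs_def] S2_def[abs_def])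
  show "self_similar_measure \<beta> p2 p1 (distr \<mu> borel ?f)"
    unfolding self_similar_measure_def
  proof (intro conjI ballI)
    show "prob_space (distr \<mu> borel ?f)" by (rule prob_space_distr) (rule measurable_reflection)
    have "?f -` {0..1} = {0..1}" by auto
    then show "measure (distr \<mu> borel ?f) {0..1} = 1"
      using eq[of "{0..1}"] ssm by (simp add: self_similar_measure_def)
    fix A :: "real set"
    assume A: "A \<in> sets borel"
    have "S1 \<beta> -` A \<in> sets borel" "S2 \<beta> -` A \<in> sets borel"
      using measurable_sets[OF S_meas(1) A] measurable_sets[OF S_meas(2) A] by simp_all
    moreover have "S1 \<beta> -` ?f -` A = ?f -` S2 \<beta> -` A" "S2 \<beta> -` ?f -` A = ?f -` S1 \<beta> -` A"
      using S by auto
    ultimately show "measure (distr \<mu> borel ?f) A =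
        p2 * measure (distr \<mu> borel ?f) (S1 \<beta> -` A) + p1 * measure (distr \<mu> borel ?f) (S2 \<beta> -` A)"
      using self_similar[OF vimage[OF A]] A by (simp add: eq)
  qed simp
qed (use m \<beta> root p1 p2 in auto)

lemma msupport_reflection:
  assumes "z \<in> msupport (distr \<mu> borel (\<lambda>x. 1 - x))"
  shows "1 - z \<in> msupport \<mu>"
proof -
  have "emeasure \<mu> U > 0" if U: "open U" "1 - z \<in> U" for U
  proof -
    have "open ((\<lambda>x. 1 - x) -` U)" using U(1) by (intro open_vimage continuous_intros)
    with assms U have "emeasure (distr \<mu> borel (\<lambda>x. 1 - x)) ((\<lambda>x. 1 - x) -` U) > 0"
      by (auto simp: msupport_def)
    moreover have "(\<lambda>x. 1 - x) -` (\<lambda>x. 1 - x) -` U = U" by auto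
    moreover have "(\<lambda>x. 1 - x) -` U \<in> sets borel" using \<open>open ((\<lambda>x. 1 - x) -` U)\<close> by simp
    ultimately show ?thesis by (simp add: emeasure_distr)
  qed
  then show ?thesis by (simp add: msupport_def)
qed

lemma measure_reflection_ball:
  "measure (distr \<mu> borel (\<lambda>x. 1 - x)) (ball z r) = measure \<mu> (ball (1 - z) r)"
proof -
  have "(\<lambda>x. 1 - x) -` ball z r = ball (1 - z) r" by (auto simp: dist_real_def)
  then show ?thesis by (simp add: measure_distr)
qed

lemma not_doubling: "\<not> doubling_measure \<mu>"
proof
  assume "doubling_measure \<mu>"
  then obtain D where D: "\<And>z r. z \<in> msupport \<mu> \<Longrightarrow> r > 0
    \<Longrightarrow> measure \<mu> (ball z (2 * r)) \<le> D * measure \<mu> (ball z r)"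
    using doubling_measureD[OF finite_measure_axioms] by blast
  show False
  proof (cases "p2 \<le> p1")
    case True
    then show ?thesis using ball_ratio_unbounded[of D] D by force
  next
    case False
    let ?\<nu> = "distr \<mu> borel (\<lambda>x. 1 - x)"
    \<comment> \<open>The reflection is an isometry, so a bad ball for the reflected measure gives
      one for \<open>\<mu>\<close> with the same radius.\<close>
    interpret reflected: multinacci_measure m \<beta> p2 p1 ?\<nu> by (rule reflection)
    obtain z r where "z \<in> msupport ?\<nu>" "r > 0" "measure ?\<nu> (ball z (2 * r)) > D * measure ?\<nu> (ball z r)"
      using reflected.ball_ratio_unbounded[of D] False by auto
    then show ?thesis
      using D[of "1 - z" r] msupport_reflection by (simp add: measure_reflection_ball)
  qed
qed

end

theorem theorem1p1:
  fixes m :: nat and \<beta> p1 p2 :: real and \<mu> :: "real measure"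
  assumes "m \<ge> 3"
    and "\<beta> > 1" and "poly (multinacci_poly m) \<beta> = 0"
    and "p1 > 0" and "p2 > 0" and "p1 + p2 = 1"
    and "self_similar_measure \<beta> p1 p2 \<mu>"
  shows "\<not> doubling_measure \<mu>"
proof -
  interpret multinacci_measure m \<beta> p1 p2 \<mu>
    using assms by unfold_locales
  show ?thesis by (rule not_doubling)
qed

end
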